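(* Let $n\ge 3$, $m=(2,\ldots,2)$, and let $d\in \operatorname{Der}(B_n^m)$ be a linear derivation. Then there exist a scalar derivation $d_\alpha$ of $B_n^m$ and a skew-symmetric derivation $d_s$ of $B_n^m$ such that $d=d_\alpha+d_s$. Moreover, this decomposition is unique.
   Context: For $m=(2,\ldots,2)$ the Fermat ring is $B_n^m=\mathbb{C}[X_1,\ldots,X_n]/(X_1^2+\cdots+X_n^2)$; $x_i$ denotes the residue class of $X_i$. $\operatorname{Der}(B_n^m)$ is the set of $\mathbb{C}$-derivations of $B_n^m$. A derivation $d$ of $B_n^m$ is called linear if there are $a_{ij}\in\mathbb{C}$ with $d(x_i)=\sum_{j=1}^n a_{ij}x_j$ for $i=1,\ldots,n$; the matrix $[d]=[a_{ij}]$ is the associated matrix of $d$. A scalar derivation is a linear derivation whose associated matrix is a scalar matrix (a complex multiple of the identity). A skew-symmetric derivation is a linear derivation whose associated matrix $A$ is skew-symmetric, i.e. $A^T=-A$. *)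

theory Defs
  imports "HOL-Analysis.Analysis" "HOL-Library.Poly_Mapping"
begin

type_synonym 'n cpoly = "('n \<Rightarrow>\<^sub>0 nat) \<Rightarrow>\<^sub>0 complex"

definition cpoly_var :: "'n \<Rightarrow> 'n cpoly" where
  "cpoly_var i = Poly_Mapping.single (Poly_Mapping.single i 1) 1"

definition cpoly_const :: "complex \<Rightarrow> 'n cpoly" where
  "cpoly_const c = Poly_Mapping.single 0 c"

definition fermat_poly :: "'n::finite cpoly" where
  "fermat_poly = (\<Sum>i\<in>UNIV. cpoly_var i ^ 2)"

text \<open>The coordinate index set is a finite type, so \<open>n\<close> is \<open>CARD('n)\<close>.  Two polynomials are
  identified when their difference lies in the principal ideal generated by \<^const>\<open>fermat_poly\<close>.\<close>

quotient_type (overloaded) 'n fermat_ring = "'n::finite cpoly" /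
  "\<lambda>p q. fermat_poly dvd (p - q)"
  morphisms fermat_rep fermat_class
proof (rule equivpI)
  show "reflp (\<lambda>p q :: 'n cpoly. fermat_poly dvd (p - q))"
    by (rule reflpI) simp
  show "symp (\<lambda>p q :: 'n cpoly. fermat_poly dvd (p - q))"
    by (rule sympI) (metis dvd_minus_iff minus_diff_eq)
  show "transp (\<lambda>p q :: 'n cpoly. fermat_poly dvd (p - q))"
  proof (rule transpI)
    fix p q r :: "'n cpoly"
    assume "fermat_poly dvd (p - q)" "fermat_poly dvd (q - r)"
    then have "fermat_poly dvd ((p - q) + (q - r))" by (rule dvd_add)
    then show "fermat_poly dvd (p - r)" by simp
  qed
qed

lemma fermat_poly_not_unit: "\<not> fermat_poly dvd (1 :: 'n::finite cpoly)"
proof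
  assume "fermat_poly dvd (1 :: 'n cpoly)"
  then obtain r :: "'n cpoly" where r: "1 = fermat_poly * r" by (rule dvdE)
  have "(0 :: 'n \<Rightarrow>\<^sub>0 nat) \<in> Poly_Mapping.keys (1 :: 'n cpoly)" by (simp add: in_keys_iff)
  then have "(0 :: 'n \<Rightarrow>\<^sub>0 nat) \<in> {a + b |a b. a \<in> Poly_Mapping.keys (fermat_poly :: 'n cpoly) \<and> b \<in> Poly_Mapping.keys r}"
    unfolding r using keys_mult[of fermat_poly r] by blast
  then obtain a b :: "'n \<Rightarrow>\<^sub>0 nat"
    where ab: "a + b = 0" and a: "a \<in> Poly_Mapping.keys (fermat_poly :: 'n cpoly)"
    by auto
  have "Poly_Mapping.lookup a k = 0" for k
    using arg_cong[OF ab, of "\<lambda>m. Poly_Mapping.lookup m k"] by (simp add: lookup_add)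
  then have a0: "a = 0" by (simp add: poly_mapping_eqI)
  have "Poly_Mapping.lookup (cpoly_var i ^ 2 :: 'n cpoly) 0 = 0" for i
  proof -
    have "Poly_Mapping.single i (Suc 0) + Poly_Mapping.single i (Suc 0) \<noteq> 0"
      by (metis add_eq_0_iff_both_eq_0 lookup_add lookup_single_eq lookup_zero nat.distinct(1))
    then show ?thesis
      by (simp add: cpoly_var_def power2_eq_square mult_single lookup_single)
  qed
  then have "Poly_Mapping.lookup (fermat_poly :: 'n cpoly) 0 = 0"
    by (simp add: fermat_poly_def lookup_sum)
  with a a0 show False by (simp add: in_keys_iff)
qed

instantiation fermat_ring :: (finite) comm_ring_1
begin

lift_definition zero_fermat_ring :: "'a fermat_ring" is 0 .

lift_definition one_fermat_ring :: "'a fermat_ring" is 1 .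

lift_definition plus_fermat_ring :: "'a fermat_ring \<Rightarrow> 'a fermat_ring \<Rightarrow> 'a fermat_ring" is "(+)"
proof -
  fix p p' q q' :: "'a cpoly"
  assume "fermat_poly dvd (p - p')" "fermat_poly dvd (q - q')"
  then have "fermat_poly dvd ((p - p') + (q - q'))" by (rule dvd_add)
  then show "fermat_poly dvd (p + q - (p' + q'))" by (simp add: algebra_simps)
qed

lift_definition uminus_fermat_ring :: "'a fermat_ring \<Rightarrow> 'a fermat_ring" is uminus
proof -
  fix p p' :: "'a cpoly"
  assume "fermat_poly dvd (p - p')"
  then have "fermat_poly dvd - (p - p')" by (simp only: dvd_minus_iff)
  then show "fermat_poly dvd (- p - - p')" by (simp add: algebra_simps)
qed

lift_definition minus_fermat_ring :: "'a fermat_ring \<Rightarrow> 'a fermat_ring \<Rightarrow> 'a fermat_ring" is "(-)"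
proof -
  fix p p' q q' :: "'a cpoly"
  assume "fermat_poly dvd (p - p')" "fermat_poly dvd (q - q')"
  then have "fermat_poly dvd ((p - p') - (q - q'))" by (rule dvd_diff)
  then show "fermat_poly dvd (p - q - (p' - q'))" by (simp add: algebra_simps)
qed

lift_definition times_fermat_ring :: "'a fermat_ring \<Rightarrow> 'a fermat_ring \<Rightarrow> 'a fermat_ring" is "(*)"
proof -
  fix p p' q q' :: "'a cpoly"
  assume "fermat_poly dvd (p - p')" "fermat_poly dvd (q - q')"
  then have "fermat_poly dvd ((p - p') * q + p' * (q - q'))"
    by (intro dvd_add dvd_mult dvd_mult2)
  then show "fermat_poly dvd (p * q - p' * q')" by (simp add: algebra_simps)
qed

instance
proof
  fix a b c :: "'a fermat_ring"
  show "a * b * c = a * (b * c)" by transfer (simp add: algebra_simps)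
  show "a * b = b * a" by transfer (simp add: algebra_simps)
  show "1 * a = a" by transfer simp
  show "a + b + c = a + (b + c)" by transfer (simp add: algebra_simps)
  show "a + b = b + a" by transfer (simp add: algebra_simps)
  show "0 + a = a" by transfer simp
  show "- a + a = 0" by transfer simp
  show "a - b = a + - b" by transfer simp
  show "(a + b) * c = a * c + b * c" by transfer (simp add: algebra_simps)
  show "(0::'a fermat_ring) \<noteq> 1"
    by transfer (simp add: fermat_poly_not_unit)
qed

end

definition fermat_var :: "'n::finite \<Rightarrow> 'n fermat_ring" where
  "fermat_var i = fermat_class (cpoly_var i)"

definition fermat_const :: "complex \<Rightarrow> 'n::finite fermat_ring" where
  "fermat_const c = fermat_class (cpoly_const c)"

definition fermat_derivation :: "('n::finite fermat_ring \<Rightarrow> 'n fermat_ring) \<Rightarrow> bool" where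
  "fermat_derivation d \<longleftrightarrow>
     (\<forall>a b. d (a + b) = d a + d b) \<and>
     (\<forall>c a. d (fermat_const c * a) = fermat_const c * d a) \<and>
     (\<forall>a b. d (a * b) = d a * b + a * d b)"

text \<open>Stated as a relation, since the matrix of a linear derivation is determined by the derivation
  only because the \<^const>\<open>fermat_var\<close> are linearly independent (the defining relation is quadratic).\<close>

definition associated_matrix ::
    "('n::finite fermat_ring \<Rightarrow> 'n fermat_ring) \<Rightarrow> complex ^ 'n ^ 'n \<Rightarrow> bool" where
  "associated_matrix d A \<longleftrightarrow>
     (\<forall>i. d (fermat_var i) = (\<Sum>j\<in>UNIV. fermat_const (A $ i $ j) * fermat_var j))"

definition linear_derivation :: "('n::finite fermat_ring \<Rightarrow> 'n fermat_ring) \<Rightarrow> bool" where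
  "linear_derivation d \<longleftrightarrow> fermat_derivation d \<and> (\<exists>A. associated_matrix d A)"

definition scalar_derivation :: "('n::finite fermat_ring \<Rightarrow> 'n fermat_ring) \<Rightarrow> bool" where
  "scalar_derivation d \<longleftrightarrow>
     fermat_derivation d \<and> (\<exists>\<alpha>. associated_matrix d (mat \<alpha>))"

definition skew_symmetric_derivation :: "('n::finite fermat_ring \<Rightarrow> 'n fermat_ring) \<Rightarrow> bool" where
  "skew_symmetric_derivation d \<longleftrightarrow>
     fermat_derivation d \<and> (\<exists>A. associated_matrix d A \<and> transpose A = - A)"

end

theory Submission
  imports Defs
begin

text \<open>
  Let \<open>A\<close> be the matrix of a linear derivation \<open>d\<close> of the Fermat ring \<open>B\<close>. Applying \<open>d\<close> to
  the relation \<open>\<Sum> x\<^sub>i\<^sup>2 = 0\<close> gives \<open>2 \<Sum> a\<^sub>i\<^sub>j x\<^sub>i x\<^sub>j = 0\<close> in \<open>B\<close>. An element of \<open>B\<close> has a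
  well-defined value at every complex point \<open>z\<close> of the isotropic cone \<open>\<Sum> z\<^sub>i\<^sup>2 = 0\<close>, so the
  quadratic form of \<open>A\<close> vanishes on this cone. Only the points \<open>e\<^sub>i + w e\<^sub>j\<close> with
  \<open>w\<^sup>2 = -1\<close> are needed: there the form takes the value
  \<open>(a\<^sub>i\<^sub>i - a\<^sub>j\<^sub>j) + (a\<^sub>i\<^sub>j + a\<^sub>j\<^sub>i) w\<close>, and since both \<open>w = \<i>\<close> and \<open>w = -\<i>\<close> are allowed,
  both brackets vanish (\<open>derivation_matrix_relations\<close>). Hence \<open>A = \<alpha> I + S\<close> with \<open>S\<close>
  skew-symmetric, where \<open>\<alpha>\<close> is the common diagonal entry.

  To split \<open>d\<close> itself one needs a derivation with matrix \<open>\<alpha> I\<close>. It is \<open>\<alpha>\<close> times the Euler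
  derivation, which multiplies each monomial by its total degree; it descends from the
  polynomial ring to \<open>B\<close> because it sends the defining form to twice itself. What remains of
  \<open>d\<close> after subtracting it is a derivation with matrix \<open>S\<close>.

  For uniqueness, the same isotropic points show that the \<open>x\<^sub>i\<close> are linearly independent
  (\<open>fermat_var_independent\<close>), so \<open>d\<close> has only one matrix. A skew-symmetric matrix has zero
  diagonal, so \<open>\<alpha>\<close> can be read off from the diagonal of that matrix. Finally a derivation is
  determined by its values on the generators (\<open>fermat_derivation_eqI\<close>), so \<open>\<alpha>\<close> determines the
  scalar part, and the skew-symmetric part is the rest.
\<close>

section \<open>Polynomials: generation, evaluation and the Euler operator\<close>

lemma poly_mapping_add_induct [case_names single add]:
  fixes p :: "'k \<Rightarrow>\<^sub>0 'b::monoid_add"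
  assumes single: "\<And>k c. P (Poly_Mapping.single k c)"
    and add: "\<And>p q. P p \<Longrightarrow> P q \<Longrightarrow> P (p + q)"
  shows "P p"
proof (induction p rule: update_induct)
  case const
  show ?case using single[of undefined 0] by simp
next
  case (update f a b)
  have "Poly_Mapping.update a b f = f + Poly_Mapping.single a b"
    using update(1)
    by (intro poly_mapping_eqI)
      (auto simp: lookup_update lookup_add lookup_single in_keys_iff when_def)
  then show ?case using add[OF update(3) single[of a b]] by simp
qed

text \<open>The polynomial ring is generated as a ring by the constants and the variables. This form of
  induction serves to show that derivations are determined by the images of the generators.\<close>

lemma cpoly_induct [case_names const var add mult]:
  fixes p :: "'n cpoly"
  assumes const: "\<And>c. P (cpoly_const c)"
    and var: "\<And>i. P (cpoly_var i)"
    and add: "\<And>p q. P p \<Longrightarrow> P q \<Longrightarrow> P (p + q)"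
    and mult: "\<And>p q. P p \<Longrightarrow> P q \<Longrightarrow> P (p * q)"
  shows "P p"
proof (induction p rule: poly_mapping_add_induct)
  case (single m c)
  have "P (Poly_Mapping.single m 1)"
  proof (induction m rule: poly_mapping_add_induct)
    case (single i k)
    show ?case
    proof (induction k)
      case 0
      show ?case using const[of 1] by (simp add: cpoly_const_def)
    next
      case (Suc k)
      have "Poly_Mapping.single (Poly_Mapping.single i (Suc k)) 1 =
          cpoly_var i * Poly_Mapping.single (Poly_Mapping.single i k) (1::complex)"
        by (simp add: cpoly_var_def mult_single flip: single_add)
      then show ?case using mult[OF var Suc.IH] by simp
    qed
  next
    case (add m m')
    have "Poly_Mapping.single (m + m') 1 =
        Poly_Mapping.single m 1 * Poly_Mapping.single m' (1::complex)"
      by (simp add: mult_single)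
    then show ?case using mult[OF add] by simp
  qed
  then have "P (cpoly_const c * Poly_Mapping.single m 1)" by (intro mult const)
  then show ?case by (simp add: cpoly_const_def mult_single)
next
  case (add p q)
  then show ?case by (rule assms)
qed

definition eval_at :: "('n::finite \<Rightarrow> complex) \<Rightarrow> 'n cpoly \<Rightarrow> complex" where
  "eval_at z p =
     (\<Sum>m\<in>Poly_Mapping.keys p. Poly_Mapping.lookup p m * (\<Prod>i\<in>UNIV. z i ^ Poly_Mapping.lookup m i))"

lemma eval_at_add: "eval_at z (p + q) = eval_at z p + eval_at z q"
  unfolding eval_at_def by (rule setsum_keys_plus_distrib) (simp_all add: algebra_simps)

lemma eval_at_single:
  "eval_at z (Poly_Mapping.single m c) = c * (\<Prod>i\<in>UNIV. z i ^ Poly_Mapping.lookup m i)"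
  by (simp add: eval_at_def)

text \<open>Both sides are biadditive, which reduces the claim to monomials.\<close>

lemma eval_at_mult: "eval_at z (p * q) = eval_at z p * eval_at z q"
proof (induction p rule: poly_mapping_add_induct)
  case (single m c)
  show ?case
    by (induction q rule: poly_mapping_add_induct)
      (simp_all add: mult_single eval_at_single eval_at_add lookup_add power_add prod.distrib
        distrib_left)
qed (simp add: eval_at_add distrib_right)

lemma eval_at_sum: "eval_at z (\<Sum>i\<in>I. f i) = (\<Sum>i\<in>I. eval_at z (f i))"
proof -
  have "eval_at z 0 = 0" by (simp add: eval_at_def)
  then show ?thesis by (induction I rule: infinite_finite_induct) (simp_all add: eval_at_add)
qed

lemma eval_at_const: "eval_at z (cpoly_const c) = c"
  by (simp add: cpoly_const_def eval_at_single)

lemma eval_at_var: "eval_at z (cpoly_var i) = z i"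
proof -
  have "(\<Prod>j\<in>UNIV. z j ^ Poly_Mapping.lookup (Poly_Mapping.single i (1::nat)) j) =
      (\<Prod>j\<in>UNIV. if j = i then z j else 1)"
    by (intro prod.cong) (auto simp: lookup_single when_def)
  also have "\<dots> = z i" by simp
  finally show ?thesis by (simp add: cpoly_var_def eval_at_single)
qed

lemma eval_at_fermat_poly: "eval_at z fermat_poly = (\<Sum>i\<in>UNIV. (z i)\<^sup>2)"
  by (simp add: fermat_poly_def eval_at_sum eval_at_mult eval_at_var power2_eq_square)

text \<open>This is the operator \<open>\<Sum> X\<^sub>i \<partial>/\<partial>X\<^sub>i\<close>. Scaling each monomial by its total degree avoids
  partial derivatives.\<close>

definition euler_op :: "'n::finite cpoly \<Rightarrow> 'n cpoly" where
  "euler_op = Poly_Mapping.mapp (\<lambda>m c. of_nat (\<Sum>i\<in>UNIV. Poly_Mapping.lookup m i) * c)"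

lemma lookup_euler_op:
  "Poly_Mapping.lookup (euler_op p) m =
     of_nat (\<Sum>i\<in>UNIV. Poly_Mapping.lookup m i) * Poly_Mapping.lookup p m"
  by (auto simp: euler_op_def lookup_mapp in_keys_iff when_def)

lemma euler_op_add: "euler_op (p + q) = euler_op p + euler_op q"
  by (intro poly_mapping_eqI) (simp add: lookup_euler_op lookup_add distrib_left)

lemma euler_op_single:
  "euler_op (Poly_Mapping.single m c) =
     Poly_Mapping.single m (of_nat (\<Sum>i\<in>UNIV. Poly_Mapping.lookup m i) * c)"
  by (intro poly_mapping_eqI) (simp add: lookup_euler_op lookup_single when_def)

text \<open>The Leibniz rule is biadditive in the two factors, so it suffices to have it for monomials,
  where it says that total degrees add.\<close>

lemma euler_op_mult: "euler_op (p * q) = euler_op p * q + p * euler_op q"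
proof (induction p rule: poly_mapping_add_induct)
  case (single m c)
  show ?case
    by (induction q rule: poly_mapping_add_induct)
      (simp_all add: mult_single euler_op_single euler_op_add lookup_add sum.distrib
        algebra_simps flip: single_add)
qed (simp add: euler_op_add algebra_simps)

lemma euler_op_const: "euler_op (cpoly_const c) = 0"
  by (simp add: cpoly_const_def euler_op_single)

lemma euler_op_var: "euler_op (cpoly_var i) = cpoly_var i"
  by (simp add: cpoly_var_def euler_op_single lookup_single when_def)

lemma euler_op_sum:
  fixes f :: "'a \<Rightarrow> 'b::finite cpoly"
  shows "euler_op (\<Sum>i\<in>I. f i) = (\<Sum>i\<in>I. euler_op (f i))"
proof -
  have "euler_op 0 = (0 :: 'b cpoly)" by (intro poly_mapping_eqI) (simp add: lookup_euler_op)
  then show ?thesis by (induction I rule: infinite_finite_induct) (simp_all add: euler_op_add)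
qed

text \<open>Euler's identity for a form of degree 2. It makes the ideal of the form invariant, so that
  the operator passes to the quotient.\<close>

lemma euler_op_fermat_poly: "euler_op fermat_poly = 2 * fermat_poly"
  by (simp add: fermat_poly_def euler_op_sum euler_op_mult euler_op_var power2_eq_square
      sum_distrib_left)

section \<open>The Fermat ring: Euler operator, isotropic points and linear forms\<close>

lemma fermat_ring_induct [case_names const var add mult]:
  fixes b :: "'n::finite fermat_ring"
  assumes "\<And>c. P (fermat_const c)"
    and "\<And>i. P (fermat_var i)"
    and "\<And>a b. P a \<Longrightarrow> P b \<Longrightarrow> P (a + b)"
    and "\<And>a b. P a \<Longrightarrow> P b \<Longrightarrow> P (a * b)"
  shows "P b"
proof -
  obtain p where b: "b = fermat_class p"
    by (metis Quotient_fermat_ring Quotient_abs_rep)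
  have "P (fermat_class p)"
    using assms
    by (induction p rule: cpoly_induct)
      (auto simp: fermat_const_def fermat_var_def
        simp flip: plus_fermat_ring.abs_eq times_fermat_ring.abs_eq)
  then show ?thesis using b by simp
qed

lift_definition fermat_euler :: "'n::finite fermat_ring \<Rightarrow> 'n fermat_ring" is euler_op
proof -
  fix p q :: "'n cpoly"
  assume "fermat_poly dvd (p - q)"
  then obtain r where r: "p = q + fermat_poly * r"
    by (metis dvd_def diff_add_cancel add.commute)
  show "fermat_poly dvd (euler_op p - euler_op q)"
    by (simp add: r euler_op_add euler_op_mult euler_op_fermat_poly)
qed

lemma fermat_const_add: "fermat_const (a + b) = fermat_const a + fermat_const b"
  by (simp add: fermat_const_def cpoly_const_def single_add plus_fermat_ring.abs_eq)

lemma fermat_const_0: "fermat_const 0 = 0"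
  by (simp add: fermat_const_def cpoly_const_def zero_fermat_ring_def)

lemma fermat_const_diff: "fermat_const (a - b) = fermat_const a - fermat_const b"
  by (metis fermat_const_add diff_add_cancel eq_diff_eq)

text \<open>Evaluation respects the relation of the ring only at points of the isotropic cone; at all
  other points the value is set to 0 in order to have a total function.\<close>

lift_definition fermat_eval :: "('n \<Rightarrow> complex) \<Rightarrow> 'n::finite fermat_ring \<Rightarrow> complex"
  is "\<lambda>z p. if (\<Sum>i\<in>UNIV. (z i)\<^sup>2) = 0 then eval_at z p else 0"
proof -
  fix z :: "'n \<Rightarrow> complex" and p q :: "'n cpoly"
  assume "fermat_poly dvd (p - q)"
  then obtain r where r: "p = q + fermat_poly * r"
    by (metis dvd_def diff_add_cancel add.commute)
  show "(if (\<Sum>i\<in>UNIV. (z i)\<^sup>2) = 0 then eval_at z p else 0) =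
      (if (\<Sum>i\<in>UNIV. (z i)\<^sup>2) = 0 then eval_at z q else 0)"
    by (simp add: r eval_at_add eval_at_mult eval_at_fermat_poly)
qed

context
  fixes z :: "'n::finite \<Rightarrow> complex"
  assumes iso: "(\<Sum>i\<in>UNIV. (z i)\<^sup>2) = 0"
begin

lemma fermat_eval_add: "fermat_eval z (a + b) = fermat_eval z a + fermat_eval z b"
  using iso by transfer (simp add: eval_at_add)

lemma fermat_eval_mult: "fermat_eval z (a * b) = fermat_eval z a * fermat_eval z b"
  using iso by transfer (simp add: eval_at_mult)

lemma fermat_eval_const: "fermat_eval z (fermat_const c) = c"
  using iso by (simp add: fermat_const_def fermat_eval.abs_eq eval_at_const)

lemma fermat_eval_var: "fermat_eval z (fermat_var i) = z i"
  using iso by (simp add: fermat_var_def fermat_eval.abs_eq eval_at_var)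

lemma fermat_eval_sum: "fermat_eval z (\<Sum>i\<in>I. f i) = (\<Sum>i\<in>I. fermat_eval z (f i))"
  using fermat_eval_const[of 0]
  by (induction I rule: infinite_finite_induct) (simp_all add: fermat_eval_add fermat_const_0)

lemmas fermat_eval_simps =
  fermat_eval_add fermat_eval_mult fermat_eval_const fermat_eval_var fermat_eval_sum

end

lemma sum_supported_on_pair:
  fixes f :: "'n::finite \<Rightarrow> 'b::comm_monoid_add"
  assumes "i \<noteq> j" and "\<And>k. k \<noteq> i \<Longrightarrow> k \<noteq> j \<Longrightarrow> f k = 0"
  shows "(\<Sum>k\<in>UNIV. f k) = f i + f j"
proof -
  have "(\<Sum>k\<in>UNIV. f k) = (\<Sum>k\<in>{i, j}. f k)"
    using assms(2) by (intro sum.mono_neutral_right) auto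
  then show ?thesis using assms(1) by simp
qed

text \<open>The point \<open>e\<^sub>i + w e\<^sub>j\<close>; it lies on the isotropic cone exactly when \<open>w\<^sup>2 = -1\<close> (for
  \<open>i \<noteq> j\<close>).\<close>

definition isotropic_point :: "'n \<Rightarrow> 'n \<Rightarrow> complex \<Rightarrow> 'n \<Rightarrow> complex" where
  "isotropic_point i j w = (\<lambda>k. if k = i then 1 else if k = j then w else 0)"

lemma sum_isotropic_point:
  fixes i j :: "'n::finite"
  assumes "i \<noteq> j"
  shows "(\<Sum>k\<in>UNIV. c k * isotropic_point i j w k) = c i + c j * w"
  by (subst sum_supported_on_pair[OF assms]) (use assms in \<open>auto simp: isotropic_point_def\<close>)

lemma isotropic_point_isotropic:
  fixes i j :: "'n::finite"
  assumes "i \<noteq> j" "w\<^sup>2 = -1"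
  shows "(\<Sum>k\<in>UNIV. (isotropic_point i j w k)\<^sup>2) = 0"
  by (subst sum_supported_on_pair[OF assms(1)]) (use assms in \<open>auto simp: isotropic_point_def\<close>)

lemma plus_minus_imaginary_eq_0:
  fixes a b :: complex
  assumes "\<And>w. w\<^sup>2 = -1 \<Longrightarrow> a + b * w = 0"
  shows "a = 0" "b = 0"
proof -
  have "a + b * \<i> = 0" "a + b * (-\<i>) = 0" by (intro assms; simp)+
  then have "2 * a = 0" "a + b * \<i> = 0" by (simp_all add: algebra_simps)
  then show "a = 0" "b = 0" by simp_all
qed

text \<open>The value of a linear form at \<open>e\<^sub>i \<plusminus> \<i> e\<^sub>j\<close> is \<open>c\<^sub>i \<plusminus> \<i> c\<^sub>j\<close>, so vanishing at both points
  kills \<open>c\<^sub>i\<close>. With a single variable there would be no \<open>j\<close>, and no isotropic point other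
  than the origin.\<close>

lemma fermat_var_independent:
  fixes c :: "'n::finite \<Rightarrow> complex"
  assumes card: "CARD('n) \<ge> 2"
    and zero: "(\<Sum>j\<in>UNIV. fermat_const (c j) * fermat_var j) = 0"
  shows "c i = 0"
proof -
  have "\<exists>j. j \<noteq> i"
  proof (rule ccontr)
    assume "\<nexists>j. j \<noteq> i"
    then have "UNIV = {i}" by auto
    then have "CARD('n) = 1" by (metis is_singletonI is_singleton_altdef)
    with card show False by simp
  qed
  then obtain j where j: "i \<noteq> j" by metis
  show ?thesis
  proof (rule plus_minus_imaginary_eq_0(1))
    fix w :: complex
    assume "w\<^sup>2 = -1"
    note iso = isotropic_point_isotropic[OF j this]
    have "fermat_eval (isotropic_point i j w) (\<Sum>j\<in>UNIV. fermat_const (c j) * fermat_var j) = 0"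
      using fermat_eval_const[OF iso, of 0] by (simp add: zero fermat_const_0)
    then show "c i + c j * w = 0"
      by (simp add: fermat_eval_simps[OF iso] sum_isotropic_point[OF j])
  qed
qed

section \<open>Derivations\<close>

lemma fermat_derivationD:
  assumes "fermat_derivation d"
  shows "d (a + b) = d a + d b" "d (fermat_const c * a) = fermat_const c * d a"
    "d (a * b) = d a * b + a * d b"
  using assms unfolding fermat_derivation_def by blast+

lemma fermat_derivation_const:
  assumes "fermat_derivation d"
  shows "d (fermat_const c) = 0"
proof -
  \<comment> \<open>The Leibniz rule for \<open>1 \<cdot> 1\<close> forces \<open>d 1 = 0\<close>, and linearity over the constants does the
    rest.\<close>
  have "d (1 * 1) = d 1 * 1 + 1 * d 1" "d (fermat_const c * 1) = fermat_const c * d 1"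
    using assms unfolding fermat_derivation_def by blast+
  then show ?thesis by simp
qed

lemma fermat_derivation_eqI:
  assumes "fermat_derivation d" "fermat_derivation d'"
    and "\<And>i. d (fermat_var i) = d' (fermat_var i)"
  shows "d = d'"
proof
  fix b
  show "d b = d' b"
  proof (induction b rule: fermat_ring_induct)
    case (const c)
    show ?case using assms by (simp add: fermat_derivation_const)
  next
    case (add a b)
    then show ?case
      by (simp add: fermat_derivationD(1)[OF assms(1)] fermat_derivationD(1)[OF assms(2)])
  next
    case (mult a b)
    then show ?case
      by (simp add: fermat_derivationD(3)[OF assms(1)] fermat_derivationD(3)[OF assms(2)])
  qed (rule assms)
qed

text \<open>With \<open>associated_matrix_euler\<close>, this provides a scalar derivation for every scalar.\<close>

lemma fermat_derivation_euler:
  "fermat_derivation (\<lambda>b :: 'n::finite fermat_ring. fermat_const \<alpha> * fermat_euler b)"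
proof -
  have add: "fermat_euler (a + b) = fermat_euler a + fermat_euler b" for a b :: "'n fermat_ring"
    by transfer (simp add: euler_op_add)
  have mult: "fermat_euler (a * b) = fermat_euler a * b + a * fermat_euler b"
    for a b :: "'n fermat_ring"
    by transfer (simp add: euler_op_mult)
  have const: "fermat_euler (fermat_const c) = (0 :: 'n fermat_ring)" for c
    by (simp add: fermat_const_def fermat_euler.abs_eq euler_op_const zero_fermat_ring_def)
  show ?thesis
    unfolding fermat_derivation_def by (simp add: add mult const algebra_simps)
qed

lemma sum_mat_mult_var:
  "(\<Sum>j\<in>UNIV. fermat_const (mat \<alpha> $ i $ j) * fermat_var j) = fermat_const \<alpha> * fermat_var i"
proof -
  have "(\<Sum>j\<in>UNIV. fermat_const (mat \<alpha> $ i $ j) * fermat_var j) =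
      (\<Sum>j\<in>UNIV. if i = j then fermat_const \<alpha> * fermat_var j else 0)"
    by (intro sum.cong) (auto simp: mat_def fermat_const_0)
  then show ?thesis by simp
qed

lemma associated_matrix_euler:
  "associated_matrix (\<lambda>b. fermat_const \<alpha> * fermat_euler b) (mat \<alpha>)"
  by (simp add: associated_matrix_def sum_mat_mult_var)
    (simp add: fermat_var_def fermat_euler.abs_eq euler_op_var)

lemma associated_matrix_add:
  assumes "associated_matrix d A" "associated_matrix d' A'"
  shows "associated_matrix (\<lambda>b. d b + d' b) (A + A')"
  using assms by (simp add: associated_matrix_def fermat_const_add distrib_right sum.distrib)

lemma associated_matrix_diff:
  assumes "associated_matrix d A" "associated_matrix d' A'"
  shows "associated_matrix (\<lambda>b. d b - d' b) (A - A')"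
  using assms by (simp add: associated_matrix_def fermat_const_diff left_diff_distrib sum_subtractf)

lemma fermat_derivation_diff:
  assumes "fermat_derivation d" "fermat_derivation d'"
  shows "fermat_derivation (\<lambda>b. d b - d' b)"
  unfolding fermat_derivation_def
  by (intro conjI allI; simp only: fermat_derivationD[OF assms(1)] fermat_derivationD[OF assms(2)])
    (simp_all add: algebra_simps fermat_derivation_const[OF assms(1)]
      fermat_derivation_const[OF assms(2)])

lemma associated_matrix_unique:
  fixes d :: "'n::finite fermat_ring \<Rightarrow> 'n fermat_ring"
  assumes "CARD('n) \<ge> 2" "associated_matrix d A" "associated_matrix d A'"
  shows "A = A'"
proof -
  have "(A - A') $ i $ j = 0" for i j
    using associated_matrix_diff[OF assms(2,3)]
    by (intro fermat_var_independent[OF assms(1), of "\<lambda>j. (A - A') $ i $ j"])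
      (simp add: associated_matrix_def)
  then show ?thesis by (simp add: vec_eq_iff)
qed

lemma sum_fermat_var_squares:
  "(\<Sum>i\<in>UNIV. fermat_var i * fermat_var i) = (0 :: 'n::finite fermat_ring)"
proof -
  have "(\<Sum>i\<in>I. fermat_class (p i)) = fermat_class (\<Sum>i\<in>I. p i)"
    for I and p :: "'n \<Rightarrow> 'n cpoly"
    by (induction I rule: infinite_finite_induct)
      (simp_all add: plus_fermat_ring.abs_eq zero_fermat_ring_def)
  then have "(\<Sum>i\<in>UNIV. fermat_var i * fermat_var i :: 'n fermat_ring) = fermat_class fermat_poly"
    by (simp add: fermat_var_def times_fermat_ring.abs_eq fermat_poly_def power2_eq_square)
  also have "\<dots> = 0" by (simp add: zero_fermat_ring_def fermat_ring.abs_eq_iff)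
  finally show ?thesis .
qed

text \<open>The derivative of the relation \<open>\<Sum> x\<^sub>k\<^sup>2 = 0\<close>, evaluated at \<open>e\<^sub>i + w e\<^sub>j\<close> for the two square
  roots \<open>w\<close> of \<open>-1\<close>, gives two linear equations that separate the two claims.\<close>

lemma derivation_matrix_relations:
  fixes d :: "'n::finite fermat_ring \<Rightarrow> 'n fermat_ring"
  assumes d: "fermat_derivation d" and A: "associated_matrix d A" and ij: "i \<noteq> j"
  shows "A $ i $ i = A $ j $ j" and "A $ i $ j + A $ j $ i = 0"
proof -
  have d_sum: "d (\<Sum>i\<in>I. f i) = (\<Sum>i\<in>I. d (f i))" for I and f :: "'n \<Rightarrow> 'n fermat_ring"
    using fermat_derivation_const[OF d, of 0]
    by (induction I rule: infinite_finite_induct)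
      (simp_all add: fermat_derivationD(1)[OF d] fermat_const_0)
  have "(\<Sum>k\<in>UNIV. d (fermat_var k) * fermat_var k + fermat_var k * d (fermat_var k)) =
      d (\<Sum>k\<in>UNIV. fermat_var k * fermat_var k)"
    by (simp only: d_sum fermat_derivationD(3)[OF d])
  also have "\<dots> = 0"
    using fermat_derivation_const[OF d, of 0] by (simp add: sum_fermat_var_squares fermat_const_0)
  finally have rel:
    "(\<Sum>k\<in>UNIV. d (fermat_var k) * fermat_var k + fermat_var k * d (fermat_var k)) = 0" .
  have *: "(A $ i $ i - A $ j $ j) + (A $ i $ j + A $ j $ i) * w = 0" if w: "w\<^sup>2 = -1" for w
  proof -
    let ?z = "isotropic_point i j w"
    note iso = isotropic_point_isotropic[OF ij w]
    have dk: "fermat_eval ?z (d (fermat_var k)) = A $ k $ i + A $ k $ j * w" for k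
      using A by (simp add: associated_matrix_def fermat_eval_simps[OF iso] sum_isotropic_point[OF ij])
    have "0 = fermat_eval ?z 0" using fermat_eval_const[OF iso, of 0] by (simp add: fermat_const_0)
    also have "\<dots> = (\<Sum>k\<in>UNIV. (2 * (A $ k $ i + A $ k $ j * w)) * ?z k)"
      unfolding rel[symmetric] fermat_eval_simps[OF iso] dk
      by (intro sum.cong) (auto simp: algebra_simps)
    also have "\<dots> = 2 * (A $ i $ i + A $ i $ j * w) + 2 * (A $ j $ i + A $ j $ j * w) * w"
      by (rule sum_isotropic_point[OF ij])
    also have "\<dots> = 2 * ((A $ i $ i + A $ j $ j * w\<^sup>2) + (A $ i $ j + A $ j $ i) * w)"
      by (simp add: algebra_simps power2_eq_square)
    finally have "2 * ((A $ i $ i - A $ j $ j) + (A $ i $ j + A $ j $ i) * w) = 0"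
      by (simp add: w)
    then show ?thesis by (simp only: mult_eq_0_iff) simp
  qed
  show "A $ i $ i = A $ j $ j" "A $ i $ j + A $ j $ i = 0"
    using plus_minus_imaginary_eq_0[OF *] by simp_all
qed

lemma derivation_matrix_scalar_plus_skew:
  assumes "fermat_derivation d" and "associated_matrix d A"
  shows "\<exists>\<alpha>. transpose (A - mat \<alpha>) = - (A - mat \<alpha>)"
proof -
  fix k
  show ?thesis
    unfolding vec_eq_iff
  proof (intro exI[of _ "A $ k $ k"] allI)
    fix i j
    show "transpose (A - mat (A $ k $ k)) $ i $ j = (- (A - mat (A $ k $ k))) $ i $ j"
    proof (cases "i = j")
      case True
      have "A $ i $ i = A $ k $ k"
        by (cases "i = k") (auto intro: derivation_matrix_relations(1)[OF assms])
      with True show ?thesis by (simp add: transpose_def mat_def)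
    next
      case False
      with derivation_matrix_relations(2)[OF assms False] show ?thesis
        by (simp add: transpose_def mat_def eq_neg_iff_add_eq_0 add.commute)
    qed
  qed
qed

text \<open>The diagonal of a skew-symmetric matrix is zero, so the scalar is the diagonal entry of the
  sum.\<close>

lemma scalar_skew_unique:
  fixes S S' :: "complex ^ 'n ^ 'n"
  assumes "mat \<alpha> + S = mat \<alpha>' + S'" "transpose S = - S" "transpose S' = - S'"
  shows "\<alpha> = \<alpha>'"
proof -
  have diag: "T $ i $ i = 0" if "transpose T = - T" for T :: "complex ^ 'n ^ 'n" and i
  proof -
    have "transpose T $ i $ i = (- T) $ i $ i" by (simp add: that)
    then show ?thesis by (simp add: transpose_def)
  qed
  fix i :: 'n
  have "(mat \<alpha> + S) $ i $ i = (mat \<alpha>' + S') $ i $ i" by (simp add: assms(1))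
  then show ?thesis using assms(2,3) by (simp add: diag mat_def)
qed

theorem theorem6:
  fixes d :: "'n::finite fermat_ring \<Rightarrow> 'n fermat_ring"
  assumes "CARD('n) \<ge> 3"
    and "linear_derivation d"
  shows "\<exists>!(d\<^sub>\<alpha>, d\<^sub>s).
    scalar_derivation d\<^sub>\<alpha> \<and> skew_symmetric_derivation d\<^sub>s \<and> d = (\<lambda>b. d\<^sub>\<alpha> b + d\<^sub>s b)"
proof -
  let ?dec = "\<lambda>e s. scalar_derivation e \<and> skew_symmetric_derivation s \<and> d = (\<lambda>b. e b + s b)"
  obtain A where d: "fermat_derivation d" and A: "associated_matrix d A"
    using assms(2) by (auto simp: linear_derivation_def)
  obtain \<alpha> where \<alpha>: "transpose (A - mat \<alpha>) = - (A - mat \<alpha>)"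
    using derivation_matrix_scalar_plus_skew[OF d A] by blast
  let ?e = "\<lambda>b. fermat_const \<alpha> * fermat_euler b"
  let ?s = "\<lambda>b. d b - ?e b"
  have "scalar_derivation ?e"
    using fermat_derivation_euler associated_matrix_euler by (auto simp: scalar_derivation_def)
  moreover have "skew_symmetric_derivation ?s"
    unfolding skew_symmetric_derivation_def
    using fermat_derivation_diff[OF d fermat_derivation_euler]
      associated_matrix_diff[OF A associated_matrix_euler] \<alpha> by blast
  ultimately have ex: "?dec ?e ?s" by simp
  have uniq: "e = e' \<and> s = s'" if dec: "?dec e s" "?dec e' s'" for e s e' s'
  proof -
    obtain \<beta> S where e: "fermat_derivation e" "associated_matrix e (mat \<beta>)"
      and s: "associated_matrix s S" "transpose S = - S"
      using dec(1) by (auto simp: scalar_derivation_def skew_symmetric_derivation_def)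
    obtain \<beta>' S' where e': "fermat_derivation e'" "associated_matrix e' (mat \<beta>')"
      and s': "associated_matrix s' S'" "transpose S' = - S'"
      using dec(2) by (auto simp: scalar_derivation_def skew_symmetric_derivation_def)
    have "associated_matrix d (mat \<beta> + S)" "associated_matrix d (mat \<beta>' + S')"
      using associated_matrix_add[OF e(2) s(1)] associated_matrix_add[OF e'(2) s'(1)] dec by simp_all
    then have "mat \<beta> + S = mat \<beta>' + S'"
      using assms(1) by (intro associated_matrix_unique[of d]) auto
    then have "\<beta> = \<beta>'" using s(2) s'(2) by (rule scalar_skew_unique)
    then have ee: "e = e'"
      using e e' by (intro fermat_derivation_eqI) (simp_all add: associated_matrix_def)
    have "e b + s b = e' b + s' b" for b using dec by metis
    then have "s = s'" by (simp add: ee fun_eq_iff)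
    with ee show ?thesis by simp
  qed
  show ?thesis
  proof (rule ex1I[of _ "(?e, ?s)"])
    show "case (?e, ?s) of (e, s) \<Rightarrow> ?dec e s" using ex by simp
  next
    fix x
    assume "case x of (e, s) \<Rightarrow> ?dec e s"
    then have "?dec (fst x) (snd x)" by (simp add: case_prod_beta)
    from uniq[OF this ex] show "x = (?e, ?s)" by (simp add: prod_eq_iff)
  qed
qed

end
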